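(* Let $\mathbf{X}=(X_1,\dots,X_d)$ be a random vector with independent components with pdfs $f_1,\dots,f_d$ and joint pdf $f(\mathbf{x})=\prod_{j=1}^d f_j(x_j)$, let $G:\mathbb{R}^d\to\mathbb{R}$ be measurable, let $i\in\{1,\dots,d\}$, and let $f_{i\delta}$ be a pdf on $\mathbb{R}$. Let $$P=\int \mathbf{1}_{\{G(\mathbf{x})<0\}}f(\mathbf{x})\,d\mathbf{x},\qquad P_{i\delta}=\int \mathbf{1}_{\{G(\mathbf{x})<0\}}\frac{f_{i\delta}(x_i)}{f_i(x_i)}f(\mathbf{x})\,d\mathbf{x},$$ with $P>0$ and $P_{i\delta}>0$. Let $\mathbf{x}^1,\mathbf{x}^2,\dots$ be independent copies of $\mathbf{X}$ and $$\hat P_N=\frac1N\sum_{n=1}^N\mathbf{1}_{\{G(\mathbf{x}^n)<0\}},\qquad \hat P_{i\delta N}=\frac1N\sum_{n=1}^N\mathbf{1}_{\{G(\mathbf{x}^n)<0\}}\frac{f_{i\delta}(x_i^n)}{f_i(x_i^n)}.$$ Let $s(x,y)=\left[\frac yx-1\right]\mathbf{1}_{\{y\ge x\}}+\left[1-\frac xy\right]\mathbf{1}_{\{y<x\}}$, and let $S_{i\delta}=s(P,P_{i\delta})$ and $\hat S_{i\delta N}=s(\hat P_N,\hat P_{i\delta N})$. Assume (i) $\mathrm{Supp}(f_{i\delta})\subseteq\mathrm{Supp}(f_i)$, (ii) $\displaystyle\int_{\mathrm{Supp}(f_i)}\frac{f_{i\delta}^2(x)}{f_i(x)}\,dx<\infty$.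 If $P\neq P_{i\delta}$, then $$\sqrt N\,\big[\hat S_{i\delta N}-S_{i\delta}\big]\xrightarrow[N\to\infty]{\mathcal{L}}\mathcal{N}\big(0,d^T\Sigma_{i\delta}\,d\big),$$ where $$\Sigma_{i\delta}=\begin{pmatrix}P(1-P)&P_{i\delta}(1-P)\\ P_{i\delta}(1-P)&\sigma_{i\delta}^2\end{pmatrix},\qquad \sigma_{i\delta}^2=\mathrm{Var}\left[\mathbf{1}_{\{G(\mathbf{X})<0\}}\frac{f_{i\delta}(X_i)}{f_i(X_i)}\right],$$ and $d=\left(\frac{\partial s}{\partial x}(P,P_{i\delta}),\frac{\partial s}{\partial y}(P,P_{i\delta})\right)^T$ with, for $x\ne y$, $$\frac{\partial s}{\partial x}(x,y)=-\frac{y}{x^2}\mathbf{1}_{\{y\ge x\}}-\frac1y\mathbf{1}_{\{y<x\}},\qquad \frac{\partial s}{\partial y}(x,y)=\frac1x\mathbf{1}_{\{y\ge x\}}+\frac{x}{y^2}\mathbf{1}_{\{y<x\}}.$$ The same convergence holds when $P=P_{i\delta}$, with $d=\left(-\frac1P,\frac1P\right)^T$; and for $x^*\neq0$ the limits of $\nabla s(x,y)$ as $(x,y)\to(x^*,x^* )$ within the region $y\ge x$ and within the region $y<x$ coincide and both equal $\left(-\frac1{x^*},\frac1{x^*}\right)^T$ (with $\nabla s$ given by the formulas above).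
   Context: $x_i^n$ denotes the $i$-th component of $\mathbf{x}^n$. $\mathrm{Supp}(g)$ denotes the set $\{x: g(x)>0\}$ where the density $g$ is positive, so the ratio $f_{i\delta}(x_i)/f_i(x_i)$ is considered only where $f_i(x_i)>0$. $S_{i\delta}$ is the density modification based reliability sensitivity index and $\hat S_{i\delta N}$ its plug-in estimator. When a denominator in $\hat S_{i\delta N}$ vanishes, $\hat S_{i\delta N}$ is given an arbitrary fixed value (e.g. $0$). $\xrightarrow{\mathcal{L}}$ denotes convergence in distribution; $\mathcal{N}(0,0)$ is the Dirac mass at $0$. *)

theory Defs
  imports "HOL-Probability.Probability"
begin

definition is_pdf :: "(real \<Rightarrow> real) \<Rightarrow> bool" where
  "is_pdf g \<longleftrightarrow>
     g \<in> borel_measurable borel \<and> (\<forall>x. 0 \<le> g x) \<and> (\<integral>\<^sup>+x. ennreal (g x) \<partial>lborel) = 1"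

definition Supp :: "(real \<Rightarrow> real) \<Rightarrow> real set" where
  "Supp g = {x. 0 < g x}"

definition joint_pdf :: "('d::finite \<Rightarrow> real \<Rightarrow> real) \<Rightarrow> real ^ 'd \<Rightarrow> real" where
  "joint_pdf f x = (\<Prod>j\<in>UNIV. f j (x $ j))"

definition failure :: "(real ^ 'd \<Rightarrow> real) \<Rightarrow> real ^ 'd \<Rightarrow> real" where
  "failure G x = indicator {x. G x < 0} x"

text \<open>Since \<open>a / 0 = 0\<close>, the weighted indicator is \<open>0\<close> wherever \<open>f i\<close> vanishes at
  the \<open>i\<close>-th component; this only affects a null set for the law with density \<open>joint_pdf f\<close>.\<close>

definition weighted_failure ::
    "('d::finite \<Rightarrow> real \<Rightarrow> real) \<Rightarrow> 'd \<Rightarrow> (real \<Rightarrow> real) \<Rightarrow> (real ^ 'd \<Rightarrow> real) \<Rightarrow> real ^ 'd \<Rightarrow> real" where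
  "weighted_failure f i f\<delta> G x = failure G x * (f\<delta> (x $ i) / f i (x $ i))"

definition fail_prob :: "('d::finite \<Rightarrow> real \<Rightarrow> real) \<Rightarrow> (real ^ 'd \<Rightarrow> real) \<Rightarrow> real" where
  "fail_prob f G = (\<integral>x. failure G x * joint_pdf f x \<partial>lborel)"

definition mod_fail_prob ::
    "('d::finite \<Rightarrow> real \<Rightarrow> real) \<Rightarrow> 'd \<Rightarrow> (real \<Rightarrow> real) \<Rightarrow> (real ^ 'd \<Rightarrow> real) \<Rightarrow> real" where
  "mod_fail_prob f i f\<delta> G = (\<integral>x. weighted_failure f i f\<delta> G x * joint_pdf f x \<partial>lborel)"

text \<open>Monte Carlo average over the sample points with indices \<open>1, \<dots>, N\<close>.\<close>

definition sample_mean :: "('v \<Rightarrow> real) \<Rightarrow> (nat \<Rightarrow> 'o \<Rightarrow> 'v) \<Rightarrow> nat \<Rightarrow> 'o \<Rightarrow> real" where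
  "sample_mean h xs N \<omega> = 1 / real N * (\<Sum>n=1..N. h (xs n \<omega>))"

definition sens :: "real \<Rightarrow> real \<Rightarrow> real" where
  "sens x y = (y / x - 1) * of_bool (y \<ge> x) + (1 - x / y) * of_bool (y < x)"

text \<open>The plug-in value takes the arbitrary constant \<open>c\<close> when a denominator vanishes.
  For the arguments used here, both nonnegative with \<open>y = 0\<close> whenever \<open>x = 0\<close>,
  the denominator of the selected branch of \<open>sens x y\<close> vanishes iff \<open>x = 0 \<or> y = 0\<close>.\<close>

definition sens_plugin :: "real \<Rightarrow> real \<Rightarrow> real \<Rightarrow> real" where
  "sens_plugin c x y = (if x = 0 \<or> y = 0 then c else sens x y)"

definition dsens_x :: "real \<Rightarrow> real \<Rightarrow> real" where
  "dsens_x x y = - (y / x\<^sup>2) * of_bool (y \<ge> x) - 1 / y * of_bool (y < x)"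

definition dsens_y :: "real \<Rightarrow> real \<Rightarrow> real" where
  "dsens_y x y = 1 / x * of_bool (y \<ge> x) + x / y\<^sup>2 * of_bool (y < x)"

definition normal_law :: "real \<Rightarrow> real \<Rightarrow> real measure" where
  "normal_law m v =
     (if v = 0 then return borel m else density lborel (\<lambda>x. ennreal (normal_density m (sqrt v) x)))"

definition asym_cov :: "real \<Rightarrow> real \<Rightarrow> real \<Rightarrow> real ^ 2 ^ 2" where
  "asym_cov P P\<delta> v = vector [vector [P * (1 - P), P\<delta> * (1 - P)],
                             vector [P\<delta> * (1 - P), v]]"

end

theory Submission
  imports Defs
begin

text \<open>The pair \<open>(failure G x, weighted_failure f i f\<delta> G x)\<close> has finite second moments, since
  \<open>E[(f\<delta> / f i)\<^sup>2]\<close> is the integral in hypothesis (ii), so \<open>S_hat\<close> is a function of an empirical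
  mean in the plane and the delta method applies. A multivariate central limit theorem is not needed:
  the linear part of the error at the true mean is a scalar i.i.d. sum, handled by the one-dimensional
  theorem, and Chebyshev's inequality together with Slutsky's theorem removes the remainder. On the
  diagonal \<open>P = P\<delta>\<close> the two branches of \<open>sens\<close> share value and gradient, so \<open>sens\<close> is still
  Frechet differentiable there.\<close>

section \<open>Reindexed independent families and Slutsky's theorem\<close>

text \<open>Relabelling the events by the inverse of \<open>h\<close> on a finite \<open>K\<close>
  turns an intersection over \<open>K\<close> into one over its image, where the product rule is
  known; injectivity carries the product back. It serves to shift a sample numbered from 1 to one
  numbered from 0.\<close>

lemma (in prob_space) indep_vars_reindex:
  assumes indep: "indep_vars M' X I" and inj: "inj_on h J" and sub: "h ` J \<subseteq> I"
  shows "indep_vars (\<lambda>j. M' (h j)) (\<lambda>j. X (h j)) J"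
proof -
  let ?F = "\<lambda>i. {X i -` A \<inter> space M | A. A \<in> sets (M' i)}"
  have F: "indep_sets ?F I" and rv: "\<And>i. i \<in> I \<Longrightarrow> random_variable (M' i) (X i)"
    using indep by (auto simp: indep_vars_def2)
  have "indep_sets (\<lambda>j. ?F (h j)) J"
    unfolding indep_sets_def
  proof (intro conjI ballI allI impI subsetI)
    fix j B assume "j \<in> J" "B \<in> ?F (h j)"
    then show "B \<in> events"
      using rv[of "h j"] sub by (auto intro: measurable_sets)
  next
    fix K A assume K: "K \<subseteq> J" "K \<noteq> {}" "finite K" and A: "A \<in> Pi K (\<lambda>j. ?F (h j))"
    have injK: "inj_on h K" using inj K(1) by (rule inj_on_subset)
    let ?A = "\<lambda>i. A (the_inv_into K h i)"
    have "prob (\<Inter>i\<in>h ` K. ?A i) = (\<Prod>i\<in>h ` K. prob (?A i))"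
    proof (rule indep_setsD[OF F])
      show "\<forall>i\<in>h ` K. ?A i \<in> ?F i"
        using A by (auto simp: the_inv_into_f_f[OF injK] Pi_def)
    qed (use K sub in auto)
    then show "prob (\<Inter>j\<in>K. A j) = (\<Prod>j\<in>K. prob (A j))"
      by (simp add: prod.reindex[OF injK] the_inv_into_f_f[OF injK])
  qed
  with rv sub show ?thesis
    by (auto simp: indep_vars_def2)
qed

text \<open>Weak convergence can be tested on the ramps \<open>cts_step x y\<close>. These are
  uniformly continuous with values in \<open>[0, 1]\<close>, so replacing \<open>A n\<close> by a
  sequence close to it in probability changes their expectations by a vanishing amount.\<close>

lemma (in prob_space) weak_conv_m_slutsky:
  fixes A B :: "nat \<Rightarrow> 'a \<Rightarrow> real"
  assumes A[measurable]: "\<And>n. random_variable borel (A n)"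
    and B[measurable]: "\<And>n. random_variable borel (B n)"
    and L: "real_distribution L"
    and conv: "weak_conv_m (\<lambda>n. distr M borel (A n)) L"
    and diff: "\<And>e. 0 < e \<Longrightarrow> (\<lambda>n. prob {\<omega> \<in> space M. e \<le> \<bar>B n \<omega> - A n \<omega>\<bar>}) \<longlonglongrightarrow> 0"
  shows "weak_conv_m (\<lambda>n. distr M borel (B n)) L"
proof (rule integral_cts_step_conv_imp_weak_conv)
  fix x y :: real assume xy: "x < y"
  let ?h = "cts_step x y"
  have uc: "uniformly_continuous_on UNIV ?h"
    by (rule cts_step_uniformly_continuous[OF xy])
  have [measurable]: "?h \<in> borel_measurable borel"
    by (intro borel_measurable_continuous_onI uniformly_continuous_imp_continuous[OF uc])
  have bounds: "0 \<le> ?h z" "?h z \<le> 1" for z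
    using xy by (auto simp: cts_step_def)
  have int: "integrable M (\<lambda>\<omega>. ?h (C \<omega>))" if [measurable]: "random_variable borel C" for C
    by (rule integrable_const_bound[of _ 1]) (use bounds in auto)
  have "(\<lambda>n. integral\<^sup>L (distr M borel (A n)) ?h) \<longlonglongrightarrow> integral\<^sup>L L ?h"
  proof (rule weak_conv_imp_integral_bdd_continuous_conv[OF _ L conv, where B = 1])
    show "isCont ?h z" for z
      using uniformly_continuous_imp_continuous[OF uc]
      by (simp add: continuous_on_eq_continuous_at)
  qed (use bounds in \<open>auto intro!: real_distribution_distr\<close>)
  then have lim: "(\<lambda>n. expectation (\<lambda>\<omega>. ?h (A n \<omega>))) \<longlonglongrightarrow> integral\<^sup>L L ?h"
    by (simp add: integral_distr)
  have "(\<lambda>n. expectation (\<lambda>\<omega>. ?h (B n \<omega>)) - expectation (\<lambda>\<omega>. ?h (A n \<omega>))) \<longlonglongrightarrow> 0"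
  proof (rule LIMSEQ_I)
    fix r :: real assume r: "0 < r"
    obtain d where d: "0 < d" "\<And>u v. \<bar>u - v\<bar> < d \<Longrightarrow> \<bar>?h u - ?h v\<bar> < r / 2"
      using uc[unfolded uniformly_continuous_on_def, rule_format, of "r / 2"] r
      by (auto simp: dist_real_def abs_minus_commute)
    obtain N where N: "\<And>n. n \<ge> N \<Longrightarrow> prob {\<omega> \<in> space M. d \<le> \<bar>B n \<omega> - A n \<omega>\<bar>} < r / 2"
      using LIMSEQ_D[OF diff[OF d(1)], of "r / 2"] r by auto
    show "\<exists>no. \<forall>n\<ge>no. norm (expectation (\<lambda>\<omega>. ?h (B n \<omega>)) - expectation (\<lambda>\<omega>. ?h (A n \<omega>)) - 0) < r"
    proof (intro exI allI impI)
      fix n assume n: "n \<ge> N"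
      let ?E = "{\<omega> \<in> space M. d \<le> \<bar>B n \<omega> - A n \<omega>\<bar>}"
      have "\<bar>expectation (\<lambda>\<omega>. ?h (B n \<omega>)) - expectation (\<lambda>\<omega>. ?h (A n \<omega>))\<bar>
          = \<bar>expectation (\<lambda>\<omega>. ?h (B n \<omega>) - ?h (A n \<omega>))\<bar>"
        by (simp add: int)
      also have "\<dots> \<le> expectation (\<lambda>\<omega>. \<bar>?h (B n \<omega>) - ?h (A n \<omega>)\<bar>)"
        by (rule integral_abs_bound)
      \<comment> \<open>Off \<open>?E\<close> the arguments are \<open>d\<close>-close and uniform
        continuity gives \<open>r / 2\<close>; on \<open>?E\<close> two values in
        \<open>[0, 1]\<close> differ by at most 1.\<close>
      also have "\<dots> \<le> expectation (\<lambda>\<omega>. r / 2 + indicator ?E \<omega>)"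
      proof (rule integral_mono)
        fix \<omega> assume "\<omega> \<in> space M"
        show "\<bar>?h (B n \<omega>) - ?h (A n \<omega>)\<bar> \<le> r / 2 + indicator ?E \<omega>"
        proof (cases "\<omega> \<in> ?E")
          case True
          then show ?thesis using bounds[of "B n \<omega>"] bounds[of "A n \<omega>"] r by auto
        next
          case False
          then show ?thesis using d(2)[of "B n \<omega>" "A n \<omega>"] \<open>\<omega> \<in> space M\<close> by auto
        qed
      qed (auto intro!: int Bochner_Integration.integrable_diff Bochner_Integration.integrable_add
            integrable_abs simp: integrable_indicator_iff less_top[symmetric])
      also have "\<dots> = r / 2 + prob ?E"
        by (subst Bochner_Integration.integral_add) (auto simp: prob_space less_top[symmetric])
      also have "\<dots> < r" using N[OF n] by simp
      finally show "norm (expectation (\<lambda>\<omega>. ?h (B n \<omega>)) - expectation (\<lambda>\<omega>. ?h (A n \<omega>)) - 0) < r"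
        by simp
    qed
  qed
  from tendsto_add[OF this lim] show "(\<lambda>n. integral\<^sup>L (distr M borel (B n)) ?h) \<longlonglongrightarrow> integral\<^sup>L L ?h"
    by (simp add: integral_distr)
qed (use L in \<open>auto intro: real_distribution_distr\<close>)

section \<open>Scaling of limit laws and the scalar central limit theorem, degenerate variance
  included\<close>

lemma cdf_distr_mult:
  fixes \<mu> :: "real measure"
  assumes [measurable_cong]: "sets \<mu> = sets borel" and "0 < a"
  shows "cdf (distr \<mu> borel ((*) a)) x = cdf \<mu> (x / a)"
proof -
  have "space \<mu> = UNIV" using sets_eq_imp_space_eq[OF assms(1)] by simp
  then have "(*) a -` {..x} \<inter> space \<mu> = {..x / a}" using \<open>0 < a\<close> by (auto simp: field_simps)
  then show ?thesis by (simp add: cdf_def measure_distr)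
qed

text \<open>The scaled distribution function at \<open>x\<close> is the original one at
  \<open>x / a\<close>, so its continuity points are exactly the multiples by \<open>a\<close> of
  the original continuity points.\<close>

lemma weak_conv_m_scale:
  assumes conv: "weak_conv_m \<mu> L" and sets: "\<And>n. sets (\<mu> n) = sets borel" "sets L = sets borel"
    and a: "0 < a"
  shows "weak_conv_m (\<lambda>n. distr (\<mu> n) borel ((*) a)) (distr L borel ((*) a))"
  unfolding weak_conv_m_def weak_conv_def
proof (intro allI impI)
  fix x assume "isCont (cdf (distr L borel ((*) a))) x"
  moreover have "cdf (distr L borel ((*) a)) = (\<lambda>x. cdf L (x / a))"
    by (simp add: fun_eq_iff cdf_distr_mult sets a)
  ultimately have *: "isCont (\<lambda>x. cdf L (x / a)) x" by (simp only:)
  \<comment> \<open>Composing with multiplication by \<open>a\<close> undoes the division and moves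
    continuity from \<open>x\<close> to \<open>x / a\<close>.\<close>
  have "isCont (\<lambda>z. cdf L (a * z / a)) (x / a)"
    by (rule isCont_o2[where f = "(*) a" and g = "\<lambda>x. cdf L (x / a)"]) (use * a in auto)
  then have "isCont (cdf L) (x / a)" using a by simp
  then show "(\<lambda>n. cdf (distr (\<mu> n) borel ((*) a)) x) \<longlonglongrightarrow> cdf (distr L borel ((*) a)) x"
    using conv by (simp add: cdf_distr_mult sets a weak_conv_m_def weak_conv_def)
qed

lemma normal_law_scale:
  assumes "0 < v"
  shows "normal_law 0 v = distr std_normal_distribution borel ((*) (sqrt v))"
proof -
  interpret N: real_distribution std_normal_distribution by (rule real_dist_normal_dist)
  \<comment> \<open>On its own law as probability space, the identity is a standard normal variable,
    so the affine rule for normal variables applies to it.\<close>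
  have "distributed std_normal_distribution lborel (\<lambda>x. x) (normal_density 0 1)"
    by (auto simp: distributed_def distr_id2 cong: distr_cong)
  from N.normal_density_affine[OF this, of "sqrt v" 0] assms
  have "distributed std_normal_distribution lborel (\<lambda>x. sqrt v * x) (normal_density 0 (sqrt v))"
    by simp
  then have "distr std_normal_distribution lborel (\<lambda>x. sqrt v * x) = density lborel (normal_density 0 (sqrt v))"
    by (simp add: distributed_def)
  moreover have "distr std_normal_distribution lborel (\<lambda>x. sqrt v * x) = distr std_normal_distribution borel (\<lambda>x. sqrt v * x)"
    by (rule distr_cong) auto
  ultimately show ?thesis using assms by (simp add: normal_law_def)
qed

lemma real_distribution_normal_law:
  assumes "0 \<le> v"
  shows "real_distribution (normal_law m v)"
proof (cases "v = 0")
  case True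
  then show ?thesis
    by (auto simp: normal_law_def real_distribution_def real_distribution_axioms_def intro: prob_space_return)
next
  case False
  then show ?thesis using assms
    by (auto simp: normal_law_def real_distribution_def real_distribution_axioms_def intro!: prob_space_normal_density)
qed

text \<open>For \<open>v = 0\<close> every \<open>Y n\<close> vanishes almost surely, and all the
  laws equal the Dirac mass at 0. For \<open>v > 0\<close> the classical theorem gives a standard
  normal limit, and the factor \<open>sqrt v\<close> is then restored by scaling.\<close>

lemma (in prob_space) central_limit_theorem_normal_law:
  fixes Y :: "nat \<Rightarrow> 'a \<Rightarrow> real"
  assumes indep: "indep_vars (\<lambda>_. borel) Y UNIV"
    and mean: "\<And>n. expectation (Y n) = 0"
    and sq: "\<And>n. integrable M (\<lambda>\<omega>. (Y n \<omega>)\<^sup>2)"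
    and var: "\<And>n. expectation (\<lambda>\<omega>. (Y n \<omega>)\<^sup>2) = v"
    and distr: "\<And>n. distr M borel (Y n) = \<mu>"
  shows "weak_conv_m (\<lambda>n. distr M borel (\<lambda>\<omega>. (\<Sum>i<n. Y i \<omega>) / sqrt (real n))) (normal_law 0 v)"
proof (cases "v = 0")
  case True
  have [measurable]: "random_variable borel (Y n)" for n
    using indep by (simp add: indep_vars_def2)
  have "AE \<omega> in M. Y n \<omega> = 0" for n
    using integral_nonneg_eq_0_iff_AE[OF sq[of n]] var[of n] True by simp
  then have ae: "AE \<omega> in M. \<forall>n. Y n \<omega> = 0" by (simp add: AE_all_countable)
  have "distr M borel (\<lambda>\<omega>. (\<Sum>i<n. Y i \<omega>) / sqrt (real n)) = distr M borel (\<lambda>_. 0)" for n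
    by (rule distr_cong_AE) (use ae in auto)
  also have "distr M borel (\<lambda>_. 0::real) = return borel 0"
    by (rule measure_eqI) (auto simp: emeasure_distr emeasure_space_1 indicator_def)
  finally show ?thesis
    using True by (simp add: weak_conv_m_def weak_conv_def normal_law_def)
next
  case False
  have "0 \<le> v" unfolding var[of 0, symmetric] by simp
  with False have v: "0 < v" by simp
  have [measurable]: "random_variable borel (Y n)" for n
    using indep by (simp add: indep_vars_def2)
  have "weak_conv_m (\<lambda>n. distr M borel (\<lambda>\<omega>. (\<Sum>i<n. Y i \<omega>) / sqrt (real n * (sqrt v)\<^sup>2)))
          std_normal_distribution"
    by (rule central_limit_theorem_zero_mean[OF indep mean _ sq _ distr]) (use v mean var in auto)
  from weak_conv_m_scale[OF this, of "sqrt v"] v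
  have "weak_conv_m (\<lambda>n. distr M borel (\<lambda>\<omega>. sqrt v * ((\<Sum>i<n. Y i \<omega>) / sqrt (real n * v)))) (normal_law 0 v)"
    by (simp add: normal_law_scale distr_distr comp_def)
  \<comment> \<open>This holds for \<open>n = 0\<close> too, where both sides are 0 because division
    by zero yields 0.\<close>
  moreover have "sqrt v * (s / sqrt (real n * v)) = s / sqrt (real n)" for s n
    using v by (simp add: real_sqrt_mult)
  ultimately show ?thesis by simp
qed

section \<open>Second moments of sums of independent centred variables\<close>

text \<open>By induction: the new summand is independent of the previous partial sum, so the cross
  term factors into a product of expectations, and these are 0.\<close>

lemma (in prob_space) expectation_sum_square_iid:
  fixes Y :: "nat \<Rightarrow> 'a \<Rightarrow> real"
  assumes indep: "indep_vars (\<lambda>_. borel) Y UNIV"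
    and mean: "\<And>n. expectation (Y n) = 0"
    and sq: "\<And>n. integrable M (\<lambda>\<omega>. (Y n \<omega>)\<^sup>2)"
    and var: "\<And>n. expectation (\<lambda>\<omega>. (Y n \<omega>)\<^sup>2) = v"
  shows "integrable M (\<lambda>\<omega>. (\<Sum>i<n. Y i \<omega>)\<^sup>2)"
    and "expectation (\<lambda>\<omega>. (\<Sum>i<n. Y i \<omega>)\<^sup>2) = real n * v"
proof -
  have [measurable]: "random_variable borel (Y n)" for n
    using indep by (simp add: indep_vars_def2)
  have int: "integrable M (Y n)" for n
    by (rule square_integrable_imp_integrable[OF _ sq]) simp
  have "integrable M (\<lambda>\<omega>. (\<Sum>i<n. Y i \<omega>)\<^sup>2) \<and> expectation (\<lambda>\<omega>. (\<Sum>i<n. Y i \<omega>)\<^sup>2) = real n * v"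
  proof (induction n)
    case (Suc n)
    let ?S = "\<lambda>\<omega>. \<Sum>i<n. Y i \<omega>"
    have ind: "indep_var borel (Y n) borel ?S"
      by (rule indep_vars_sum) (use indep_vars_subset[OF indep] in auto)
    have intS: "integrable M ?S" using int by auto
    have prod: "integrable M (\<lambda>\<omega>. Y n \<omega> * ?S \<omega>)" "expectation (\<lambda>\<omega>. Y n \<omega> * ?S \<omega>) = 0"
      using indep_var_integrable[OF ind int intS] indep_var_lebesgue_integral[OF ind int intS]
      by (simp_all add: mean)
    have eq: "(\<Sum>i<Suc n. Y i \<omega>)\<^sup>2 = ?S \<omega> ^ 2 + 2 * (Y n \<omega> * ?S \<omega>) + (Y n \<omega>)\<^sup>2" for \<omega>
      by (simp add: power2_sum algebra_simps)
    show ?case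
      unfolding eq using Suc prod sq[of n] var[of n]
      by (simp add: algebra_simps)
  qed simp
  then show "integrable M (\<lambda>\<omega>. (\<Sum>i<n. Y i \<omega>)\<^sup>2)"
    and "expectation (\<lambda>\<omega>. (\<Sum>i<n. Y i \<omega>)\<^sup>2) = real n * v" by auto
qed

lemma same_distr_integral:
  fixes h :: "'b::topological_space \<Rightarrow> real"
  assumes [measurable]: "X \<in> borel_measurable M" "Y \<in> borel_measurable M" "h \<in> borel_measurable borel"
    and "distr M borel X = distr M borel Y"
  shows "integrable M (\<lambda>\<omega>. h (X \<omega>)) \<longleftrightarrow> integrable M (\<lambda>\<omega>. h (Y \<omega>))"
    and "(\<integral>\<omega>. h (X \<omega>) \<partial>M) = (\<integral>\<omega>. h (Y \<omega>) \<partial>M)"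
  using integrable_distr_eq[of X M borel h] integrable_distr_eq[of Y M borel h]
    integral_distr[of X M borel h] integral_distr[of Y M borel h] assms by simp_all

lemma (in finite_measure) square_norm_integrable_imp_integrable:
  fixes X :: "'a \<Rightarrow> 'e::{banach, second_countable_topology}"
  assumes [measurable]: "X \<in> borel_measurable M" and sq: "integrable M (\<lambda>\<omega>. (norm (X \<omega>))\<^sup>2)"
  shows "integrable M X"
proof -
  have "integrable M (\<lambda>\<omega>. norm (X \<omega>))"
    by (rule square_integrable_imp_integrable[OF _ sq]) simp
  then show ?thesis by (simp add: integrable_norm_iff)
qed

lemma norm_power2_eq_sum_Basis:
  fixes x :: "'e::euclidean_space"
  shows "(norm x)\<^sup>2 = (\<Sum>b\<in>Basis. (x \<bullet> b)\<^sup>2)"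
  unfolding power2_norm_eq_inner by (subst euclidean_inner) (simp add: power2_eq_square)

text \<open>The squared norm is the sum of the squared coordinates, so the scalar identity is
  applied along each basis vector and the results are added. With Chebyshev's inequality this bounds
  the fluctuations of a vector-valued mean.\<close>

lemma (in prob_space) expectation_norm_sum_square_iid:
  fixes C :: "nat \<Rightarrow> 'a \<Rightarrow> 'e::euclidean_space"
  assumes indep: "indep_vars (\<lambda>_. borel) C UNIV"
    and distr: "\<And>n. distr M borel (C n) = distr M borel (C 0)"
    and sq: "integrable M (\<lambda>\<omega>. (norm (C 0 \<omega>))\<^sup>2)"
    and mean: "expectation (C 0) = 0"
  shows "integrable M (\<lambda>\<omega>. (norm (\<Sum>i<n. C i \<omega>))\<^sup>2)"
    and "expectation (\<lambda>\<omega>. (norm (\<Sum>i<n. C i \<omega>))\<^sup>2) = real n * expectation (\<lambda>\<omega>. (norm (C 0 \<omega>))\<^sup>2)"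
proof -
  have [measurable]: "random_variable borel (C n)" for n
    using indep by (simp add: indep_vars_def2)
  have transfer: "integrable M (\<lambda>\<omega>. h (C n \<omega>)) = integrable M (\<lambda>\<omega>. h (C 0 \<omega>))"
    "expectation (\<lambda>\<omega>. h (C n \<omega>)) = expectation (\<lambda>\<omega>. h (C 0 \<omega>))"
    if "h \<in> borel_measurable borel" for h :: "'e \<Rightarrow> real" and n
    by (rule same_distr_integral[OF _ _ that distr]; simp)+
  have int0: "integrable M (C 0)"
    by (rule square_norm_integrable_imp_integrable[OF _ sq]) simp
  have sqb0: "integrable M (\<lambda>\<omega>. (C 0 \<omega> \<bullet> b)\<^sup>2)" if b: "b \<in> Basis" for b
    by (rule Bochner_Integration.integrable_bound[OF sq])
      (use Basis_le_norm[OF b] in \<open>auto intro!: AE_I2 simp: abs_le_square_iff[symmetric]\<close>)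
  have *: "integrable M (\<lambda>\<omega>. (\<Sum>i<n. C i \<omega> \<bullet> b)\<^sup>2)"
    "expectation (\<lambda>\<omega>. (\<Sum>i<n. C i \<omega> \<bullet> b)\<^sup>2) = real n * expectation (\<lambda>\<omega>. (C 0 \<omega> \<bullet> b)\<^sup>2)"
    if b: "b \<in> Basis" for b
  proof -
    have i: "indep_vars (\<lambda>_. borel) (\<lambda>n \<omega>. C n \<omega> \<bullet> b) UNIV"
      by (rule indep_vars_compose2[OF indep]) simp
    have m: "expectation (\<lambda>\<omega>. C n \<omega> \<bullet> b) = 0" for n
      using transfer(2)[of "\<lambda>x. x \<bullet> b" n] int0 by (simp add: mean)
    have s: "integrable M (\<lambda>\<omega>. (C n \<omega> \<bullet> b)\<^sup>2)" for n
      using transfer(1)[of "\<lambda>x. (x \<bullet> b)\<^sup>2" n] sqb0[OF b] by simp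
    have v: "expectation (\<lambda>\<omega>. (C n \<omega> \<bullet> b)\<^sup>2) = expectation (\<lambda>\<omega>. (C 0 \<omega> \<bullet> b)\<^sup>2)" for n
      using transfer(2)[of "\<lambda>x. (x \<bullet> b)\<^sup>2" n] by simp
    show "integrable M (\<lambda>\<omega>. (\<Sum>i<n. C i \<omega> \<bullet> b)\<^sup>2)"
      "expectation (\<lambda>\<omega>. (\<Sum>i<n. C i \<omega> \<bullet> b)\<^sup>2) = real n * expectation (\<lambda>\<omega>. (C 0 \<omega> \<bullet> b)\<^sup>2)"
      by (rule expectation_sum_square_iid[OF i m s v])+
  qed
  show "integrable M (\<lambda>\<omega>. (norm (\<Sum>i<n. C i \<omega>))\<^sup>2)"
    using * by (simp add: norm_power2_eq_sum_Basis inner_sum_left)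
  show "expectation (\<lambda>\<omega>. (norm (\<Sum>i<n. C i \<omega>))\<^sup>2) = real n * expectation (\<lambda>\<omega>. (norm (C 0 \<omega>))\<^sup>2)"
    using * sqb0 by (simp add: norm_power2_eq_sum_Basis inner_sum_left sum_distrib_left)
qed

section \<open>The delta method in a Euclidean space\<close>

text \<open>Here \<open>B n\<close> is the scaled error and \<open>A n\<close> its linear part, a
  normalised sum of the scalars \<open>D (C i)\<close>. Their difference is \<open>sqrt n\<close>
  times a remainder that is small compared with the norm of \<open>\<Delta> n\<close>, while
  \<open>sqrt n\<close> times that norm stays bounded in probability.\<close>

theorem (in prob_space) delta_method:
  fixes W :: "nat \<Rightarrow> 'a \<Rightarrow> 'e::euclidean_space" and g :: "'e \<Rightarrow> real"
  assumes indep: "indep_vars (\<lambda>_. borel) W UNIV"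
    and distr: "\<And>n. distr M borel (W n) = distr M borel (W 0)"
    and sq: "integrable M (\<lambda>\<omega>. (norm (W 0 \<omega>))\<^sup>2)"
    and g[measurable]: "g \<in> borel_measurable borel"
    and der: "(g has_derivative D) (at (expectation (W 0)))"
  shows "weak_conv_m
      (\<lambda>n. distr M borel (\<lambda>\<omega>. sqrt (real n) * (g ((1 / real n) *\<^sub>R (\<Sum>i<n. W i \<omega>)) - g (expectation (W 0)))))
      (normal_law 0 (variance (\<lambda>\<omega>. D (W 0 \<omega>))))"
proof -
  define m where "m = expectation (W 0)"
  define C where "C n \<omega> = W n \<omega> - m" for n \<omega>
  define \<Delta> where "\<Delta> n \<omega> = (1 / real n) *\<^sub>R (\<Sum>i<n. C i \<omega>)" for n \<omega>
  define V where "V = expectation (\<lambda>\<omega>. (norm (C 0 \<omega>))\<^sup>2)"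
  define A where "A n \<omega> = (\<Sum>i<n. D (C i \<omega>)) / sqrt (real n)" for n \<omega>
  define B where "B n \<omega> = sqrt (real n) * (g ((1 / real n) *\<^sub>R (\<Sum>i<n. W i \<omega>)) - g m)" for n \<omega>
  interpret D: bounded_linear D using der by (rule has_derivative_bounded_linear)
  have [measurable]: "D \<in> borel_measurable borel"
    by (intro borel_measurable_continuous_onI D.continuous_on continuous_on_id)
  have [measurable]: "random_variable borel (W n)" for n
    using indep by (simp add: indep_vars_def2)
  have [measurable]: "random_variable borel (C n)" for n
    unfolding C_def by measurable
  have int: "integrable M (W 0)"
    by (rule square_norm_integrable_imp_integrable[OF _ sq]) simp
  have indC: "indep_vars (\<lambda>_. borel) C UNIV"
    unfolding C_def by (rule indep_vars_compose2[OF indep]) simp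
  have distrC: "distr M borel (C n) = distr M borel (C 0)" for n
  proof -
    have "distr M borel (C k) = distr (distr M borel (W k)) borel (\<lambda>x. x - m)" for k
      by (subst distr_distr) (auto simp: C_def[abs_def] comp_def)
    then show ?thesis using distr[of n] by simp
  qed
  \<comment> \<open>Expanding the inner product leaves the squared norm of \<open>W 0\<close>, terms
    linear in \<open>W 0\<close> and a constant, all integrable.\<close>
  have sqC: "integrable M (\<lambda>\<omega>. (norm (C 0 \<omega>))\<^sup>2)"
    unfolding C_def power2_norm_eq_inner
    using sq int by (simp add: inner_diff power2_norm_eq_inner)
  have meanC: "expectation (C 0) = 0"
    unfolding C_def using int by (simp add: m_def prob_space)
  have V0: "0 \<le> V" unfolding V_def by simp
  \<comment> \<open>Chebyshev's inequality for the norm of the sum. It is used below at scale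
    \<open>t\<close> proportional to \<open>n\<close>, as a law of large numbers, and at scale
    \<open>sqrt n\<close>, as boundedness in probability.\<close>
  have tail: "prob {\<omega> \<in> space M. t \<le> norm (\<Sum>i<n. C i \<omega>)} \<le> real n * V / t\<^sup>2" if t: "0 < t" for t n
  proof -
    have "prob {\<omega> \<in> space M. t \<le> \<bar>norm (\<Sum>i<n. C i \<omega>)\<bar>} \<le> expectation (\<lambda>\<omega>. (norm (\<Sum>i<n. C i \<omega>))\<^sup>2) / t\<^sup>2"
      by (rule second_moment_method[OF _ expectation_norm_sum_square_iid(1)[OF indC distrC sqC meanC] t]) simp
    then show ?thesis
      by (simp add: expectation_norm_sum_square_iid(2)[OF indC distrC sqC meanC] V_def)
  qed
  have convA: "weak_conv_m (\<lambda>n. distr M borel (A n)) (normal_law 0 (variance (\<lambda>\<omega>. D (W 0 \<omega>))))"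
    unfolding A_def
  proof (rule central_limit_theorem_normal_law)
    show "indep_vars (\<lambda>_. borel) (\<lambda>n \<omega>. D (C n \<omega>)) UNIV"
      by (rule indep_vars_compose2[OF indC]) simp
    have law: "distr M borel (\<lambda>\<omega>. D (C n \<omega>)) = distr (distr M borel (C 0)) borel D" for n
      by (subst distrC[of n, symmetric]) (simp add: distr_distr comp_def)
    then show "distr M borel (\<lambda>\<omega>. D (C n \<omega>)) = distr (distr M borel (C 0)) borel D" for n .
    have transfer: "integrable M (\<lambda>\<omega>. h (D (C n \<omega>))) = integrable M (\<lambda>\<omega>. h (D (C 0 \<omega>)))"
      "expectation (\<lambda>\<omega>. h (D (C n \<omega>))) = expectation (\<lambda>\<omega>. h (D (C 0 \<omega>)))"
      if "h \<in> borel_measurable borel" for h :: "real \<Rightarrow> real" and n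
      by (rule same_distr_integral[OF _ _ that]; simp add: law)+
    have intC: "integrable M (C 0)"
      unfolding C_def using int by simp
    show "expectation (\<lambda>\<omega>. D (C n \<omega>)) = 0" for n
      using transfer(2)[of "\<lambda>x. x" n] integral_bounded_linear[OF D.bounded_linear_axioms intC] meanC
      by (simp add: D.zero)
    obtain K where K: "\<And>x. norm (D x) \<le> norm x * K" using D.bounded by blast
    have "integrable M (\<lambda>\<omega>. (D (C 0 \<omega>))\<^sup>2)"
    proof (rule Bochner_Integration.integrable_bound)
      show "integrable M (\<lambda>\<omega>. K\<^sup>2 * (norm (C 0 \<omega>))\<^sup>2)" using sqC by simp
      show "AE \<omega> in M. norm ((D (C 0 \<omega>))\<^sup>2) \<le> norm (K\<^sup>2 * (norm (C 0 \<omega>))\<^sup>2)"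
      proof (rule AE_I2)
        fix \<omega>
        have "(norm (D (C 0 \<omega>)))\<^sup>2 \<le> (norm (C 0 \<omega>) * K)\<^sup>2"
          by (rule power_mono[OF K]) simp
        then show "norm ((D (C 0 \<omega>))\<^sup>2) \<le> norm (K\<^sup>2 * (norm (C 0 \<omega>))\<^sup>2)"
          by (simp add: power_mult_distrib mult.commute)
      qed
    qed simp
    then show "integrable M (\<lambda>\<omega>. (D (C n \<omega>))\<^sup>2)" for n
      using transfer(1)[of "\<lambda>x. x\<^sup>2" n] by simp
    \<comment> \<open>As \<open>D\<close> commutes with expectation, \<open>D (C 0)\<close> is
      \<open>D (W 0)\<close> minus its own mean, and its second moment is a variance.\<close>
    have "expectation (\<lambda>\<omega>. D (W 0 \<omega>)) = D m"
      using integral_bounded_linear[OF D.bounded_linear_axioms int] by (simp add: m_def)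
    then show "expectation (\<lambda>\<omega>. (D (C n \<omega>))\<^sup>2) = variance (\<lambda>\<omega>. D (W 0 \<omega>))" for n
      using transfer(2)[of "\<lambda>x. x\<^sup>2" n] by (simp add: C_def D.diff)
  qed
  have "weak_conv_m (\<lambda>n. distr M borel (B n)) (normal_law 0 (variance (\<lambda>\<omega>. D (W 0 \<omega>))))"
  proof (rule weak_conv_m_slutsky[OF _ _ _ convA])
    show "random_variable borel (A n)" "random_variable borel (B n)" for n
      unfolding A_def B_def by measurable
    show "real_distribution (normal_law 0 (variance (\<lambda>\<omega>. D (W 0 \<omega>))))"
      by (rule real_distribution_normal_law) simp
    fix e :: real assume e: "0 < e"
    show "(\<lambda>n. prob {\<omega> \<in> space M. e \<le> \<bar>B n \<omega> - A n \<omega>\<bar>}) \<longlonglongrightarrow> 0"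
    proof (rule LIMSEQ_I)
      fix r :: real assume r: "0 < r"
      \<comment> \<open>Chosen so that \<open>V / K\<^sup>2 = V * r / (2 * (V + 1))\<close> lies
        below \<open>r / 2\<close>; the summand 1 keeps \<open>K\<close> positive when
        \<open>V = 0\<close>.\<close>
      define K where "K = sqrt (2 * (V + 1) / r)"
      have K: "0 < K" "V / K\<^sup>2 < r / 2"
        using r V0 by (auto simp: K_def field_simps)
      \<comment> \<open>The tolerance \<open>e / (2 * K)\<close> makes the scaled remainder at most
        \<open>e / 2\<close> as soon as \<open>sqrt n\<close> times the deviation is at most
        \<open>K\<close>.\<close>
      obtain d where d: "0 < d"
        "\<And>y. norm (y - m) < d \<Longrightarrow> \<bar>g y - g m - D (y - m)\<bar> \<le> e / (2 * K) * norm (y - m)"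
        using der[unfolded has_derivative_at_alt, THEN conjunct2, rule_format, of "e / (2 * K)"] e K
        by (auto simp: m_def)
      have "(\<lambda>n. V / d\<^sup>2 / real n) \<longlonglongrightarrow> 0" by (rule lim_const_over_n)
      from LIMSEQ_D[OF this, of "r / 2"] r
      obtain N where N: "\<And>n. n \<ge> N \<Longrightarrow> \<bar>V / d\<^sup>2 / real n\<bar> < r / 2" by auto
      show "\<exists>no. \<forall>n\<ge>no. norm (prob {\<omega> \<in> space M. e \<le> \<bar>B n \<omega> - A n \<omega>\<bar>} - 0) < r"
      proof (intro exI allI impI)
        \<comment> \<open>The bound 1 excludes \<open>n = 0\<close>, for which the empirical mean
          would be 0 by convention and could not be centred at \<open>m\<close>.\<close>
        fix n assume n: "max 1 N \<le> n"
        then have n0: "0 < n" by simp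
        let ?S = "\<lambda>\<omega>. norm (\<Sum>i<n. C i \<omega>)"
        let ?E1 = "{\<omega> \<in> space M. real n * d \<le> ?S \<omega>}"
        let ?E2 = "{\<omega> \<in> space M. K * sqrt (real n) \<le> ?S \<omega>}"
        have mean: "(1 / real n) *\<^sub>R (\<Sum>i<n. W i \<omega>) - m = \<Delta> n \<omega>" for \<omega>
          using n0 by (simp add: \<Delta>_def C_def sum_subtractf scaleR_diff_right scaleR_conv_of_real[symmetric] sum_constant_scaleR)
        have A: "A n \<omega> = sqrt (real n) * D (\<Delta> n \<omega>)" for \<omega>
        proof -
          have "s / sqrt (real n) = sqrt (real n) * s / real n" for s
            using n0 by (simp add: field_simps)
          then show ?thesis by (simp add: A_def \<Delta>_def D.scaleR D.sum)
        qed
        \<comment> \<open>Outside \<open>?E1\<close> the mean is within \<open>d\<close> of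
          \<open>m\<close>, so the derivative estimate applies; outside \<open>?E2\<close> that
          estimate is strictly below \<open>e\<close>.\<close>
        have "{\<omega> \<in> space M. e \<le> \<bar>B n \<omega> - A n \<omega>\<bar>} \<subseteq> ?E1 \<union> ?E2"
        proof (rule subsetI, rule ccontr)
          fix \<omega> assume "\<omega> \<in> {\<omega> \<in> space M. e \<le> \<bar>B n \<omega> - A n \<omega>\<bar>}" "\<omega> \<notin> ?E1 \<union> ?E2"
          then have big: "e \<le> \<bar>B n \<omega> - A n \<omega>\<bar>" and S1: "?S \<omega> < real n * d" and S2: "?S \<omega> < K * sqrt (real n)"
            by auto
          have nd: "norm (\<Delta> n \<omega>) = ?S \<omega> / real n" by (simp add: \<Delta>_def)
          have "norm (\<Delta> n \<omega>) < d" using S1 n0 by (simp add: nd field_simps)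
          then have "\<bar>g ((1 / real n) *\<^sub>R (\<Sum>i<n. W i \<omega>)) - g m - D (\<Delta> n \<omega>)\<bar> \<le> e / (2 * K) * norm (\<Delta> n \<omega>)"
            using d(2)[of "(1 / real n) *\<^sub>R (\<Sum>i<n. W i \<omega>)"] by (simp only: mean)
          then have "sqrt (real n) * \<bar>g ((1 / real n) *\<^sub>R (\<Sum>i<n. W i \<omega>)) - g m - D (\<Delta> n \<omega>)\<bar>
              \<le> sqrt (real n) * (e / (2 * K) * norm (\<Delta> n \<omega>))"
            by (rule mult_left_mono) simp
          moreover have "\<bar>B n \<omega> - A n \<omega>\<bar> = sqrt (real n) * \<bar>g ((1 / real n) *\<^sub>R (\<Sum>i<n. W i \<omega>)) - g m - D (\<Delta> n \<omega>)\<bar>"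
            by (simp add: A B_def abs_mult right_diff_distrib[symmetric])
          moreover have "sqrt (real n) * (e / (2 * K) * norm (\<Delta> n \<omega>)) = e / (2 * K) * (?S \<omega> / sqrt (real n))"
          proof -
            have "sqrt (real n) * (e / (2 * K) * norm (\<Delta> n \<omega>)) = e / (2 * K) * (?S \<omega> * (sqrt (real n) / real n))"
              by (simp add: nd)
            moreover have "sqrt (real n) / real n = 1 / sqrt (real n)"
              by (simp add: sqrt_divide_self_eq inverse_eq_divide)
            ultimately show ?thesis by simp
          qed
          moreover have "e / (2 * K) * (?S \<omega> / sqrt (real n)) \<le> e / (2 * K) * K"
            using S2 e K n0 by (intro mult_left_mono) (auto simp: field_simps)
          moreover have "e / (2 * K) * K < e" using e K by simp
          ultimately show False using big by linarith
        qed
        then have "prob {\<omega> \<in> space M. e \<le> \<bar>B n \<omega> - A n \<omega>\<bar>} \<le> prob (?E1 \<union> ?E2)"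
          by (intro finite_measure_mono) measurable
        also have "\<dots> \<le> prob ?E1 + prob ?E2"
          by (rule measure_Un_le) measurable
        also have "\<dots> \<le> real n * V / (real n * d)\<^sup>2 + real n * V / (K * sqrt (real n))\<^sup>2"
          using n0 d K by (intro add_mono tail) auto
        also have "\<dots> = V / d\<^sup>2 / real n + V / K\<^sup>2"
          using n0 by (simp add: power_mult_distrib) (simp add: power2_eq_square)
        also have "\<dots> < r"
        proof -
          have "N \<le> n" using n by simp
          then show ?thesis
            using abs_ge_self[of "V / d\<^sup>2 / real n"] N[of n] K(2) by linarith
        qed
        finally show "norm (prob {\<omega> \<in> space M. e \<le> \<bar>B n \<omega> - A n \<omega>\<bar>} - 0) < r" by simp
      qed
    qed
  qed
  then show ?thesis by (simp add: B_def[abs_def] m_def)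
qed

section \<open>Product densities and the law of a vector with independent components\<close>

text \<open>Tonelli's theorem for products indexed by \<open>Basis\<close>, transported along the
  bijection that sends an index \<open>j\<close> to the unit vector \<open>axis j 1\<close>.\<close>

lemma nn_integral_lborel_prod_cart:
  fixes f :: "'d::finite \<Rightarrow> real \<Rightarrow> ennreal"
  assumes [measurable]: "\<And>j. f j \<in> borel_measurable borel"
  shows "(\<integral>\<^sup>+x. (\<Prod>j\<in>UNIV. f j (x $ j)) \<partial>lborel) = (\<Prod>j\<in>UNIV. \<integral>\<^sup>+x. f j x \<partial>lborel)"
proof -
  have bij: "bij_betw (\<lambda>j::'d. axis j (1::real)) UNIV Basis"
    by (auto simp: bij_betw_def inj_on_def axis_eq_axis Basis_vec_def)
  have "(\<Prod>j\<in>UNIV. f j (x $ j)) = (\<Prod>b\<in>Basis. f (axis_index b) (x \<bullet> b))" for x :: "real ^ 'd"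
    by (subst prod.reindex_bij_betw[OF bij, symmetric]) (simp add: inner_axis)
  then have "(\<integral>\<^sup>+x. (\<Prod>j\<in>UNIV. f j (x $ j)) \<partial>lborel)
      = (\<Prod>b\<in>(Basis :: (real ^ 'd) set). \<integral>\<^sup>+x. f (axis_index b) x \<partial>lborel)"
    using nn_integral_lborel_prod[of "\<lambda>b :: real ^ 'd. f (axis_index b)"] by simp
  also have "\<dots> = (\<Prod>j\<in>UNIV. \<integral>\<^sup>+x. f j x \<partial>lborel)"
    by (subst prod.reindex_bij_betw[OF bij, symmetric]) simp
  finally show ?thesis .
qed

lemma borel_measurable_cart:
  fixes X :: "'a \<Rightarrow> real ^ 'd::finite"
  assumes "\<And>j. (\<lambda>\<omega>. X \<omega> $ j) \<in> borel_measurable M"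
  shows "X \<in> borel_measurable M"
  using assms by (subst borel_measurable_euclidean_space) (auto simp: Basis_vec_def inner_axis)

text \<open>Open boxes form an intersection-stable generator of the Borel sets. On a box,
  independence gives a product of one-dimensional integrals, which Tonelli's theorem reassembles
  into the integral of the joint density.\<close>

lemma (in prob_space) distr_indep_components:
  fixes X :: "'a \<Rightarrow> real ^ 'd::finite"
  assumes distr: "\<And>j. distributed M lborel (\<lambda>\<omega>. X \<omega> $ j) (\<lambda>x. ennreal (f j x))"
    and indep: "indep_vars (\<lambda>_. borel) (\<lambda>j \<omega>. X \<omega> $ j) UNIV"
    and f[measurable]: "\<And>j. f j \<in> borel_measurable borel" and nonneg: "\<And>j x. 0 \<le> f j x"
  shows "distr M borel X = density lborel (\<lambda>x. ennreal (joint_pdf f x))"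
proof (rule measure_eqI_generator_eq)
  have [measurable]: "random_variable borel (\<lambda>\<omega>. X \<omega> $ j)" for j
    using indep by (simp add: indep_vars_def2)
  have X[measurable]: "random_variable borel X"
    by (rule borel_measurable_cart) simp
  let ?E = "range (\<lambda>(a, b). box a b :: (real ^ 'd) set)"
  show "Int_stable ?E"
    by (auto simp: Int_stable_def box_Int_box)
  show "?E \<subseteq> Pow UNIV" by simp
  show "sets (distr M borel X) = sigma_sets UNIV ?E"
    "sets (density lborel (\<lambda>x. ennreal (joint_pdf f x))) = sigma_sets UNIV ?E"
    by (simp_all add: borel_eq_box)
  \<comment> \<open>Uniqueness of measures needs a sequence in the generator that covers the space
    with finite mass; growing centred cubes provide it.\<close>
  show "range (\<lambda>i::nat. box (- (real i *\<^sub>R One)) (real i *\<^sub>R One)) \<subseteq> ?E" by auto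
  show "(\<Union>i::nat. box (- (real i *\<^sub>R One)) (real i *\<^sub>R One :: real ^ 'd)) = UNIV"
    by (rule UN_box_eq_UNIV)
  show "emeasure (distr M borel X) (box (- (real i *\<^sub>R One)) (real i *\<^sub>R One)) \<noteq> \<infinity>" for i
    by (simp add: emeasure_distr emeasure_eq_measure)
  fix B :: "(real ^ 'd) set" assume "B \<in> ?E"
  then obtain a b where B: "B = box a b" by auto
  let ?I = "\<lambda>j. {a $ j<..<b $ j}"
  have "emeasure (distr M borel X) B = emeasure M (\<Inter>j\<in>UNIV. (\<lambda>\<omega>. X \<omega> $ j) -` ?I j \<inter> space M)"
    by (auto simp: B emeasure_distr mem_box_cart intro!: arg_cong[where f = "emeasure M"])
  also have "\<dots> = ennreal (\<Prod>j\<in>UNIV. prob ((\<lambda>\<omega>. X \<omega> $ j) -` ?I j \<inter> space M))"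
    by (subst indep_varsD_finite[OF indep, symmetric]) (auto simp: emeasure_eq_measure)
  also have "\<dots> = (\<Prod>j\<in>UNIV. emeasure M ((\<lambda>\<omega>. X \<omega> $ j) -` ?I j \<inter> space M))"
    by (simp add: prod_ennreal emeasure_eq_measure)
  also have "\<dots> = (\<Prod>j\<in>UNIV. \<integral>\<^sup>+x. ennreal (f j x) * indicator (?I j) x \<partial>lborel)"
    by (intro prod.cong refl distributed_emeasure[OF distr]) simp
  also have "\<dots> = (\<integral>\<^sup>+x. (\<Prod>j\<in>UNIV. ennreal (f j (x $ j)) * indicator (?I j) (x $ j)) \<partial>lborel)"
    by (rule nn_integral_lborel_prod_cart[symmetric]) simp
  also have "\<dots> = (\<integral>\<^sup>+x. ennreal (joint_pdf f x) * indicator B x \<partial>lborel)"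
  proof (intro nn_integral_cong)
    fix x :: "real ^ 'd"
    have "(\<Prod>j\<in>UNIV. indicator (?I j) (x $ j) :: ennreal) = indicator B x"
      by (auto simp: B mem_box_cart indicator_def)
    then show "(\<Prod>j\<in>UNIV. ennreal (f j (x $ j)) * indicator (?I j) (x $ j)) = ennreal (joint_pdf f x) * indicator B x"
      by (simp add: prod.distrib joint_pdf_def prod_ennreal nonneg)
  qed
  also have "\<dots> = emeasure (density lborel (\<lambda>x. ennreal (joint_pdf f x))) B"
    by (subst emeasure_density) (auto simp: B joint_pdf_def)
  finally show "emeasure (distr M borel X) B = emeasure (density lborel (\<lambda>x. ennreal (joint_pdf f x))) B" .
qed

section \<open>Differentiability of \<open>sens\<close> and one-sided limits of its gradient\<close>

text \<open>Both branches obey the same first-order estimate around the same value, so it holds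
  whichever one \<open>Q\<close> selects at each point. This covers the diagonal, where every
  neighbourhood meets both regions.\<close>

lemma has_derivative_If_both:
  assumes "(f has_derivative D) (at x)" "(g has_derivative D) (at x)" "f x = g x"
  shows "((\<lambda>z. if Q z then f z else g z) has_derivative D) (at x)"
  unfolding has_derivative_within_alt2
proof (intro conjI allI impI)
  show "bounded_linear D" using assms(1) by (rule has_derivative_bounded_linear)
  fix e :: real assume e: "0 < e"
  show "\<forall>\<^sub>F y in at x. norm ((if Q y then f y else g y) - (if Q x then f x else g x) - D (y - x)) \<le> e * norm (y - x)"
    using assms(1)[unfolded has_derivative_within_alt2, THEN conjunct2, rule_format, OF e]
      assms(2)[unfolded has_derivative_within_alt2, THEN conjunct2, rule_format, OF e]
    by eventually_elim (use assms(3) in auto)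
qed

lemma has_derivative_transform_nhds:
  assumes "(f has_derivative D) (at x)" and ev: "\<forall>\<^sub>F z in nhds x. f z = g z"
  shows "(g has_derivative D) (at x)"
proof (rule has_derivative_transform_eventually[OF assms(1)])
  show "\<forall>\<^sub>F z in at x. f z = g z"
    using ev by (auto simp: eventually_at_filter elim: eventually_mono)
  show "f x = g x" using ev by (rule eventually_nhds_x_imp_x)
qed simp

text \<open>Off the diagonal the strict inequality persists nearby, so one branch is active;
  accordingly only the denominator of that branch is required to be nonzero.\<close>

lemma has_real_derivative_sens:
  assumes "x \<noteq> y" "x \<le> y \<Longrightarrow> x \<noteq> 0" "y < x \<Longrightarrow> y \<noteq> 0"
  shows "((\<lambda>t. sens t y) has_real_derivative dsens_x x y) (at x)"
    and "((\<lambda>t. sens x t) has_real_derivative dsens_y x y) (at y)"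
proof -
  show "((\<lambda>t. sens t y) has_real_derivative dsens_x x y) (at x)"
  proof (cases "x < y")
    case True
    have ev: "\<forall>\<^sub>F t in nhds x. sens t y = y / t - 1"
      using order_tendstoD(2)[OF filterlim_ident True] by eventually_elim (simp add: sens_def)
    have "((\<lambda>t. y / t - 1) has_real_derivative dsens_x x y) (at x)"
      using assms True by (auto intro!: derivative_eq_intros simp: dsens_x_def power2_eq_square)
    then show ?thesis by (subst DERIV_cong_ev[OF refl ev refl])
  next
    case False
    then have "y < x" using assms(1) by simp
    have ev: "\<forall>\<^sub>F t in nhds x. sens t y = 1 - t / y"
      using order_tendstoD(1)[OF filterlim_ident \<open>y < x\<close>] by eventually_elim (simp add: sens_def)
    have "((\<lambda>t. 1 - t / y) has_real_derivative dsens_x x y) (at x)"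
      using assms \<open>y < x\<close> by (auto intro!: derivative_eq_intros simp: dsens_x_def)
    then show ?thesis by (subst DERIV_cong_ev[OF refl ev refl])
  qed
  show "((\<lambda>t. sens x t) has_real_derivative dsens_y x y) (at y)"
  proof (cases "x < y")
    case True
    have ev: "\<forall>\<^sub>F t in nhds y. sens x t = t / x - 1"
      using order_tendstoD(1)[OF filterlim_ident True] by eventually_elim (simp add: sens_def)
    have "((\<lambda>t. t / x - 1) has_real_derivative dsens_y x y) (at y)"
      using assms True by (auto intro!: derivative_eq_intros simp: dsens_y_def)
    then show ?thesis by (subst DERIV_cong_ev[OF refl ev refl])
  next
    case False
    then have "y < x" using assms(1) by simp
    have ev: "\<forall>\<^sub>F t in nhds y. sens x t = 1 - x / t"
      using order_tendstoD(2)[OF filterlim_ident \<open>y < x\<close>] by eventually_elim (simp add: sens_def)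
    have "((\<lambda>t. 1 - x / t) has_real_derivative dsens_y x y) (at y)"
      using assms \<open>y < x\<close> by (auto intro!: derivative_eq_intros simp: dsens_y_def power2_eq_square)
    then show ?thesis by (subst DERIV_cong_ev[OF refl ev refl])
  qed
qed

text \<open>Near a point with positive coordinates no denominator vanishes, so the value
  \<open>c\<close> is not taken there. Off the diagonal a single branch remains; on it the two
  branches share value and derivative.\<close>

lemma has_derivative_sens_plugin:
  fixes p q :: real
  assumes p: "0 < p" and q: "0 < q"
  shows "((\<lambda>z. sens_plugin c (fst z) (snd z)) has_derivative (\<lambda>h. dsens_x p q * fst h + dsens_y p q * snd h)) (at (p, q))"
proof -
  let ?D = "\<lambda>h. dsens_x p q * fst h + dsens_y p q * snd h"
  let ?f = "\<lambda>z::real \<times> real. snd z / fst z - 1" and ?g = "\<lambda>z::real \<times> real. 1 - fst z / snd z"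
  have lim: "(fst \<longlongrightarrow> p) (nhds (p, q))" "(snd \<longlongrightarrow> q) (nhds (p, q))"
    using tendsto_fst[OF filterlim_ident, of "(p, q)"] tendsto_snd[OF filterlim_ident, of "(p, q)"] by auto
  have pos: "\<forall>\<^sub>F z in nhds (p, q). 0 < fst z \<and> 0 < snd z"
    using order_tendstoD(1)[OF lim(1) p] order_tendstoD(1)[OF lim(2) q] by eventually_elim simp
  have plugin: "sens_plugin c (fst z) (snd z) = (if fst z \<le> snd z then ?f z else ?g z)"
    if "0 < fst z \<and> 0 < snd z" for z
    using that by (auto simp: sens_plugin_def sens_def)
  have f: "(?f has_derivative ?D) (at (p, q))" if "p \<le> q"
    using that p q by (auto intro!: derivative_eq_intros simp: dsens_x_def dsens_y_def field_simps power2_eq_square)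
  \<comment> \<open>For \<open>p = q\<close> the coefficients in \<open>?D\<close> come from the
    branch \<open>y \<ge> x\<close>, so agreement with the derivative of the other branch needs a
    case of its own.\<close>
  have g: "(?g has_derivative ?D) (at (p, q))" if "q \<le> p"
    using that p q by (cases "p = q")
      (auto intro!: derivative_eq_intros simp: dsens_x_def dsens_y_def field_simps power2_eq_square)
  consider "p < q" | "q < p" | "p = q" by linarith
  then have "((\<lambda>z. if fst z \<le> snd z then ?f z else ?g z) has_derivative ?D) (at (p, q))"
  proof cases
    case 1
    have "((\<lambda>z. snd z - fst z) \<longlongrightarrow> q - p) (nhds (p, q))" by (intro tendsto_intros lim)
    then have "\<forall>\<^sub>F z in nhds (p, q). 0 < snd z - fst z" by (rule order_tendstoD(1)) (use 1 in simp)
    then have ev: "\<forall>\<^sub>F z in nhds (p, q). ?f z = (if fst z \<le> snd z then ?f z else ?g z)"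
      by eventually_elim simp
    show ?thesis
      by (rule has_derivative_transform_nhds[OF f ev]) (use 1 in auto)
  next
    case 2
    have "((\<lambda>z. snd z - fst z) \<longlongrightarrow> q - p) (nhds (p, q))" by (intro tendsto_intros lim)
    then have "\<forall>\<^sub>F z in nhds (p, q). snd z - fst z < 0" by (rule order_tendstoD(2)) (use 2 in simp)
    then have ev: "\<forall>\<^sub>F z in nhds (p, q). ?g z = (if fst z \<le> snd z then ?f z else ?g z)"
      by eventually_elim simp
    show ?thesis
      by (rule has_derivative_transform_nhds[OF g ev]) (use 2 in auto)
  next
    case 3
    show ?thesis by (rule has_derivative_If_both[OF f g]) (use 3 p in auto)
  qed
  moreover from pos have ev: "\<forall>\<^sub>F z in nhds (p, q). (if fst z \<le> snd z then ?f z else ?g z) = sens_plugin c (fst z) (snd z)"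
    by eventually_elim (simp add: plugin)
  ultimately show ?thesis
    by (rule has_derivative_transform_nhds)
qed

lemma tendsto_vector_2:
  fixes f g :: "'a \<Rightarrow> real"
  assumes "(f \<longlongrightarrow> a) F" "(g \<longlongrightarrow> b) F"
  shows "((\<lambda>x. vector [f x, g x] :: real ^ 2) \<longlongrightarrow> vector [a, b]) F"
proof (rule vec_tendstoI)
  fix i :: 2
  show "((\<lambda>x. (vector [f x, g x] :: real ^ 2) $ i) \<longlongrightarrow> (vector [a, b] :: real ^ 2) $ i) F"
    using exhaust_2[of i] assms by (auto simp: vector_2)
qed

text \<open>Within each region the gradient is one rational expression, continuous at
  \<open>(a, a)\<close>; the limits agree because \<open>a / a\<^sup>2 = 1 / a\<close>.\<close>

lemma tendsto_dsens_diagonal: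
  assumes a: "a \<noteq> 0"
  shows "((\<lambda>(x, y). vector [dsens_x x y, dsens_y x y] :: real ^ 2) \<longlongrightarrow> vector [- (1 / a), 1 / a])
             (at (a, a) within {(x, y). y \<ge> x})"
    and "((\<lambda>(x, y). vector [dsens_x x y, dsens_y x y] :: real ^ 2) \<longlongrightarrow> vector [- (1 / a), 1 / a])
             (at (a, a) within {(x, y). y < x})"
proof -
  have lim: "(fst \<longlongrightarrow> a) (at (a, a) within S)" "(snd \<longlongrightarrow> a) (at (a, a) within S)" for S
    using tendsto_fst[OF tendsto_ident_at, of "(a, a)" S] tendsto_snd[OF tendsto_ident_at, of "(a, a)" S] by auto
  let ?S = "{(x, y). y \<ge> x} :: (real \<times> real) set" and ?T = "{(x, y). y < x} :: (real \<times> real) set"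
  have "((\<lambda>z. vector [- (snd z / (fst z)\<^sup>2), 1 / fst z] :: real ^ 2) \<longlongrightarrow> vector [- (a / a\<^sup>2), 1 / a]) (at (a, a) within ?S)"
    by (intro tendsto_vector_2 tendsto_intros lim) (use a in auto)
  moreover have "\<forall>\<^sub>F z in at (a, a) within ?S. vector [- (snd z / (fst z)\<^sup>2), 1 / fst z]
      = (\<lambda>(x, y). vector [dsens_x x y, dsens_y x y] :: real ^ 2) z"
    by (auto simp: eventually_at_filter dsens_x_def dsens_y_def intro!: always_eventually)
  ultimately show "((\<lambda>(x, y). vector [dsens_x x y, dsens_y x y] :: real ^ 2) \<longlongrightarrow> vector [- (1 / a), 1 / a])
             (at (a, a) within ?S)"
    using a by (auto simp: power2_eq_square intro: Lim_transform_eventually)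
  have "((\<lambda>z. vector [- (1 / snd z), fst z / (snd z)\<^sup>2] :: real ^ 2) \<longlongrightarrow> vector [- (1 / a), a / a\<^sup>2]) (at (a, a) within ?T)"
    by (intro tendsto_vector_2 tendsto_intros lim) (use a in auto)
  moreover have "\<forall>\<^sub>F z in at (a, a) within ?T. vector [- (1 / snd z), fst z / (snd z)\<^sup>2]
      = (\<lambda>(x, y). vector [dsens_x x y, dsens_y x y] :: real ^ 2) z"
    by (auto simp: eventually_at_filter dsens_x_def dsens_y_def intro!: always_eventually)
  ultimately show "((\<lambda>(x, y). vector [dsens_x x y, dsens_y x y] :: real ^ 2) \<longlongrightarrow> vector [- (1 / a), 1 / a])
             (at (a, a) within ?T)"
    using a by (auto simp: power2_eq_square intro: Lim_transform_eventually)
qed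

section \<open>Asymptotic law of the plug-in sensitivity estimator\<close>

theorem proposition3p2:
  fixes M :: "'o measure"
    and X :: "'o \<Rightarrow> real ^ 'd::finite"
    and xs :: "nat \<Rightarrow> 'o \<Rightarrow> real ^ 'd"
    and f :: "'d \<Rightarrow> real \<Rightarrow> real"
    and G :: "real ^ 'd \<Rightarrow> real"
    and i :: 'd
    and f\<delta> :: "real \<Rightarrow> real"
    and P P\<delta> S \<sigma>2 c :: real
    and S_hat :: "nat \<Rightarrow> 'o \<Rightarrow> real"
    and \<Sigma>\<delta> :: "real ^ 2 ^ 2"
  assumes "prob_space M"
    and "\<And>j. is_pdf (f j)"
    and "\<And>j. distributed M lborel (\<lambda>\<omega>. X \<omega> $ j) (\<lambda>x. ennreal (f j x))"
    and "prob_space.indep_vars M (\<lambda>_. borel) (\<lambda>j \<omega>. X \<omega> $ j) UNIV"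
    and "G \<in> borel_measurable borel"
    and "is_pdf f\<delta>"
    and "P = fail_prob f G"
    and "P\<delta> = mod_fail_prob f i f\<delta> G"
    and "P > 0"
    and "P\<delta> > 0"
    and "prob_space.indep_vars M (\<lambda>_. borel) xs {1..}"
    and "\<And>n. n \<ge> 1 \<Longrightarrow> distr M borel (xs n) = distr M borel X"
    and "S = sens P P\<delta>"
    and "S_hat = (\<lambda>N \<omega>. sens_plugin c (sample_mean (failure G) xs N \<omega>)
                                     (sample_mean (weighted_failure f i f\<delta> G) xs N \<omega>))"
    and "Supp f\<delta> \<subseteq> Supp (f i)"
    and "(\<integral>\<^sup>+x\<in>Supp (f i). ennreal ((f\<delta> x)\<^sup>2 / f i x) \<partial>lborel) < \<infinity>"
    and "\<sigma>2 = prob_space.variance M (\<lambda>\<omega>. weighted_failure f i f\<delta> G (X \<omega>))"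
    and "\<Sigma>\<delta> = asym_cov P P\<delta> \<sigma>2"
  shows "(\<forall>x y. x \<noteq> y \<and> (x \<le> y \<longrightarrow> x \<noteq> 0) \<and> (y < x \<longrightarrow> y \<noteq> 0) \<longrightarrow>
           ((\<lambda>t. sens t y) has_real_derivative dsens_x x y) (at x) \<and>
           ((\<lambda>t. sens x t) has_real_derivative dsens_y x y) (at y)) \<and>
         (P \<noteq> P\<delta> \<longrightarrow>
           (let d = vector [deriv (\<lambda>x. sens x P\<delta>) P, deriv (\<lambda>y. sens P y) P\<delta>] :: real ^ 2
            in weak_conv_m (\<lambda>N. distr M borel (\<lambda>\<omega>. sqrt (real N) * (S_hat N \<omega> - S)))
                           (normal_law 0 (d \<bullet> (\<Sigma>\<delta> *v d))))) \<and>
         (P = P\<delta> \<longrightarrow>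
           (let d = vector [- (1 / P), 1 / P] :: real ^ 2
            in weak_conv_m (\<lambda>N. distr M borel (\<lambda>\<omega>. sqrt (real N) * (S_hat N \<omega> - S)))
                           (normal_law 0 (d \<bullet> (\<Sigma>\<delta> *v d))))) \<and>
         (\<forall>a. a \<noteq> 0 \<longrightarrow>
           ((\<lambda>(x, y). vector [dsens_x x y, dsens_y x y] :: real ^ 2) \<longlongrightarrow> vector [- (1 / a), 1 / a])
             (at (a, a) within {(x, y). y \<ge> x}) \<and>
           ((\<lambda>(x, y). vector [dsens_x x y, dsens_y x y] :: real ^ 2) \<longlongrightarrow> vector [- (1 / a), 1 / a])
             (at (a, a) within {(x, y). y < x}))"
proof -
  interpret prob_space M by fact
  note pdf = assms(2) and dist = assms(3) and indX = assms(4) and pdf\<delta> = assms(6)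
    and P = assms(7) and P\<delta> = assms(8) and Ppos = assms(9) and P\<delta>pos = assms(10)
    and indxs = assms(11) and distxs = assms(12) and S = assms(13) and S_hat = assms(14)
    and fin = assms(16) and \<sigma>2 = assms(17) and \<Sigma>\<delta> = assms(18)
  have [measurable]: "f j \<in> borel_measurable borel" and f0: "0 \<le> f j x" for j x
    using pdf[of j] by (auto simp: is_pdf_def)
  have [measurable]: "f\<delta> \<in> borel_measurable borel"
    using pdf\<delta> by (auto simp: is_pdf_def)
  have [measurable]: "G \<in> borel_measurable borel" by fact
  let ?F = "failure G" and ?w = "weighted_failure f i f\<delta> G"
  have F[measurable]: "?F \<in> borel_measurable borel" unfolding failure_def by measurable
  have w[measurable]: "?w \<in> borel_measurable borel" unfolding weighted_failure_def by measurable
  have [measurable]: "random_variable borel (\<lambda>\<omega>. X \<omega> $ j)" for j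
    using indX by (simp add: indep_vars_def2)
  have X[measurable]: "random_variable borel X"
    by (rule borel_measurable_cart) simp
  have law: "distr M borel X = density lborel (\<lambda>x. ennreal (joint_pdf f x))"
    by (rule distr_indep_components[OF dist indX]) (use f0 in auto)
  have joint0: "0 \<le> joint_pdf f x" for x
    by (simp add: joint_pdf_def prod_nonneg f0)
  have [measurable]: "joint_pdf f \<in> borel_measurable borel"
    unfolding joint_pdf_def by measurable
  have density: "expectation (\<lambda>\<omega>. h (X \<omega>)) = (\<integral>x. h x * joint_pdf f x \<partial>lborel)"
    if [measurable]: "h \<in> borel_measurable borel" for h :: "real ^ 'd \<Rightarrow> real"
  proof -
    have "expectation (\<lambda>\<omega>. h (X \<omega>)) = integral\<^sup>L (distr M borel X) h"
      by (simp add: integral_distr)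
    then show ?thesis
      unfolding law by (subst (asm) integral_density) (auto simp: joint0 mult.commute)
  qed
  have EF: "expectation (\<lambda>\<omega>. ?F (X \<omega>)) = P" and Ew: "expectation (\<lambda>\<omega>. ?w (X \<omega>)) = P\<delta>"
    by (simp_all add: density P P\<delta> fail_prob_def mod_fail_prob_def)
  have F01: "?F x = 0 \<or> ?F x = 1" for x
    by (auto simp: failure_def indicator_def)
  have FF: "?F x * ?F x = ?F x" and Fn: "\<bar>?F x\<bar> \<le> 1" for x
    using F01[of x] by (auto simp: weighted_failure_def)
  have intF: "integrable M (\<lambda>\<omega>. ?F (X \<omega>))"
    by (rule integrable_const_bound[of _ 1]) (use Fn in auto)
  \<comment> \<open>Dropping the 0-1 factor leaves the second moment of the ratio under
    \<open>f i\<close>; one power of \<open>f i\<close> cancels, which gives the integral assumed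
    finite.\<close>
  have sqw: "integrable M (\<lambda>\<omega>. (?w (X \<omega>))\<^sup>2)"
  proof (rule integrableI_bounded)
    have "(\<integral>\<^sup>+\<omega>. ennreal (norm ((?w (X \<omega>))\<^sup>2)) \<partial>M) \<le> (\<integral>\<^sup>+\<omega>. ennreal ((f\<delta> (X \<omega> $ i) / f i (X \<omega> $ i))\<^sup>2) \<partial>M)"
    proof (intro nn_integral_mono ennreal_leI)
      fix \<omega>
      show "norm ((?w (X \<omega>))\<^sup>2) \<le> (f\<delta> (X \<omega> $ i) / f i (X \<omega> $ i))\<^sup>2"
        using F01[of "X \<omega>"] by (auto simp: weighted_failure_def)
    qed
    also have "\<dots> = (\<integral>\<^sup>+x. ennreal (f i x) * ennreal ((f\<delta> x / f i x)\<^sup>2) \<partial>lborel)"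
      by (rule distributed_nn_integral[OF dist, symmetric]) simp
    also have "\<dots> = (\<integral>\<^sup>+x\<in>Supp (f i). ennreal ((f\<delta> x)\<^sup>2 / f i x) \<partial>lborel)"
    proof (rule nn_integral_cong)
      fix x
      show "ennreal (f i x) * ennreal ((f\<delta> x / f i x)\<^sup>2) = ennreal ((f\<delta> x)\<^sup>2 / f i x) * indicator (Supp (f i)) x"
      \<comment> \<open>Where \<open>f i\<close> vanishes both sides are 0: the density kills the
        left one, the indicator of the support the right one.\<close>
      proof (cases "f i x = 0")
        case False
        with f0[of i x] have "0 < f i x" by simp
        then show ?thesis
          by (simp add: Supp_def ennreal_mult'[symmetric] power_divide power2_eq_square)
      qed (simp add: Supp_def)
    qed
    finally show "(\<integral>\<^sup>+\<omega>. ennreal (norm ((?w (X \<omega>))\<^sup>2)) \<partial>M) < \<infinity>"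
      using fin by (rule le_less_trans)
  qed simp
  have intw: "integrable M (\<lambda>\<omega>. ?w (X \<omega>))"
    by (rule square_integrable_imp_integrable[OF _ sqw]) simp
  have Eww: "expectation (\<lambda>\<omega>. (?w (X \<omega>))\<^sup>2) = \<sigma>2 + P\<delta>\<^sup>2"
    using variance_eq[OF intw sqw] by (simp add: \<sigma>2 Ew)

  \<comment> \<open>With the gradient taken from the formulas, one limit theorem serves both
    \<open>P \<noteq> P\<delta>\<close> and \<open>P = P\<delta>\<close>; the two cases separate
    only when \<open>a\<close> and \<open>b\<close> are identified at the end.\<close>
  define a where "a = dsens_x P P\<delta>"
  define b where "b = dsens_y P P\<delta>"
  \<comment> \<open>The shift by \<open>Suc\<close> reconciles the sample, numbered from 1, with the
    delta method, numbered from 0.\<close>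
  define W where "W n \<omega> = (?F (xs (Suc n) \<omega>), ?w (xs (Suc n) \<omega>))" for n \<omega>
  have [measurable]: "random_variable borel (xs (Suc n))" for n
    using indxs by (simp add: indep_vars_def2)
  have transfer: "expectation (\<lambda>\<omega>. h (xs (Suc n) \<omega>)) = expectation (\<lambda>\<omega>. h (X \<omega>))"
    "integrable M (\<lambda>\<omega>. h (xs (Suc n) \<omega>)) = integrable M (\<lambda>\<omega>. h (X \<omega>))"
    if "h \<in> borel_measurable borel" for h :: "real ^ 'd \<Rightarrow> real" and n
    by (rule same_distr_integral[OF _ _ that]; simp add: distxs)+
  have indW: "indep_vars (\<lambda>_. borel) W UNIV"
    unfolding W_def
    by (rule indep_vars_compose2[OF indep_vars_reindex[OF indxs, of Suc UNIV]]) auto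
  have distW: "distr M borel (W n) = distr M borel (W 0)" for n
  proof -
    have "distr M borel (W k) = distr (distr M borel (xs (Suc k))) borel (\<lambda>x. (?F x, ?w x))" for k
      by (subst distr_distr) (auto simp: W_def[abs_def] comp_def)
    then show ?thesis by (simp add: distxs)
  qed
  have sqW: "integrable M (\<lambda>\<omega>. (norm (W 0 \<omega>))\<^sup>2)"
  proof -
    \<comment> \<open>The first component takes only the values 0 and 1, so it equals its
      square.\<close>
    have "(norm (W 0 \<omega>))\<^sup>2 = ?F (xs (Suc 0) \<omega>) + (?w (xs (Suc 0) \<omega>))\<^sup>2" for \<omega>
      using FF[of "xs (Suc 0) \<omega>"] by (simp add: W_def norm_Pair power2_eq_square)
    then show ?thesis
      using transfer(2)[of "\<lambda>x. ?F x + (?w x)\<^sup>2" 0] intF sqw by simp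
  qed
  have [measurable]: "random_variable borel (W n)" for n
    unfolding W_def by measurable
  have intW: "integrable M (W 0)"
    by (rule square_norm_integrable_imp_integrable[OF _ sqW]) simp
  have meanW: "expectation (W 0) = (P, P\<delta>)"
  proof (rule prod_eqI)
    show "fst (expectation (W 0)) = fst (P, P\<delta>)"
      using integral_bounded_linear[OF bounded_linear_fst intW] transfer(1)[OF F, of 0]
      by (simp add: W_def EF)
    show "snd (expectation (W 0)) = snd (P, P\<delta>)"
      using integral_bounded_linear[OF bounded_linear_snd intW] transfer(1)[OF w, of 0]
      by (simp add: W_def Ew)
  qed
  have [measurable]: "(\<lambda>z. sens_plugin c (fst z) (snd z)) \<in> borel_measurable borel"
    unfolding sens_plugin_def sens_def of_bool_def borel_prod[symmetric] by measurable
  have S': "S = sens_plugin c P P\<delta>"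
    using Ppos P\<delta>pos by (simp add: S sens_plugin_def)
  \<comment> \<open>Valid also for \<open>n = 0\<close>, where both sides are zero.\<close>
  have mean: "(sample_mean ?F xs n \<omega>, sample_mean ?w xs n \<omega>) = (1 / real n) *\<^sub>R (\<Sum>i<n. W i \<omega>)" for n \<omega>
    by (simp add: prod_eq_iff fst_sum snd_sum W_def sample_mean_def sum.atLeast1_atMost_eq)
  have var: "variance (\<lambda>\<omega>. a * fst (W 0 \<omega>) + b * snd (W 0 \<omega>)) = (vector [a, b] :: real ^ 2) \<bullet> (\<Sigma>\<delta> *v vector [a, b])"
  proof -
    let ?h = "\<lambda>x. a * ?F x + b * ?w x"
    \<comment> \<open>Since \<open>?F\<close> is 0-1 valued and is a factor of \<open>?w\<close>,
      the product of \<open>?F\<close> and \<open>?w\<close> is \<open>?w\<close>. Its mean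
      \<open>P\<delta>\<close> yields the covariance \<open>P\<delta> * (1 - P)\<close>.\<close>
    have h2: "(?h x)\<^sup>2 = a\<^sup>2 * ?F x + 2 * a * b * ?w x + b\<^sup>2 * (?w x)\<^sup>2" for x
      using F01[of x] by (elim disjE) (simp_all add: weighted_failure_def power2_eq_square algebra_simps)
    have "variance (\<lambda>\<omega>. a * fst (W 0 \<omega>) + b * snd (W 0 \<omega>)) = variance (\<lambda>\<omega>. ?h (X \<omega>))"
      using transfer(1)[of ?h 0] transfer(1)[of "\<lambda>x. (?h x - expectation (\<lambda>\<omega>. ?h (X \<omega>)))\<^sup>2" 0]
      by (simp add: W_def)
    also have "\<dots> = expectation (\<lambda>\<omega>. (?h (X \<omega>))\<^sup>2) - (expectation (\<lambda>\<omega>. ?h (X \<omega>)))\<^sup>2"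
      by (rule variance_eq) (use intF intw sqw in \<open>simp_all add: h2\<close>)
    also have "expectation (\<lambda>\<omega>. ?h (X \<omega>)) = a * P + b * P\<delta>"
      using intF intw by (simp add: EF Ew)
    also have "expectation (\<lambda>\<omega>. (?h (X \<omega>))\<^sup>2) = a\<^sup>2 * P + 2 * a * b * P\<delta> + b\<^sup>2 * (\<sigma>2 + P\<delta>\<^sup>2)"
      unfolding h2 using intF intw sqw by (simp add: EF Ew Eww)
    finally show ?thesis
      by (simp add: \<Sigma>\<delta> asym_cov_def inner_vec_def matrix_vector_mult_def sum_2 vector_2 power2_eq_square algebra_simps)
  qed
  have conv: "weak_conv_m (\<lambda>N. distr M borel (\<lambda>\<omega>. sqrt (real N) * (S_hat N \<omega> - S)))
      (normal_law 0 ((vector [a, b] :: real ^ 2) \<bullet> (\<Sigma>\<delta> *v vector [a, b])))"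
    using delta_method[OF indW distW sqW, of "\<lambda>z. sens_plugin c (fst z) (snd z)" "\<lambda>h. a * fst h + b * snd h"]
      has_derivative_sens_plugin[OF Ppos P\<delta>pos, of c]
    by (simp add: meanW var a_def[symmetric] b_def[symmetric] mean[symmetric] S_hat S')
  have "deriv (\<lambda>x. sens x P\<delta>) P = a" "deriv (\<lambda>y. sens P y) P\<delta> = b" if "P \<noteq> P\<delta>"
    unfolding a_def b_def using that Ppos P\<delta>pos by (auto intro!: DERIV_imp_deriv has_real_derivative_sens)
  \<comment> \<open>On the diagonal the formulas select the branch \<open>y \<ge> x\<close>, and
    \<open>P / P\<^sup>2\<close> reduces to \<open>1 / P\<close>.\<close>
  moreover have "a = - (1 / P)" "b = 1 / P" if "P = P\<delta>"
    using that Ppos by (auto simp: a_def b_def dsens_x_def dsens_y_def power2_eq_square)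
  ultimately show ?thesis
    using conv has_real_derivative_sens tendsto_dsens_diagonal by (auto simp: Let_def)
qed

end
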